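(* Let $G=(V,E)$ be a finite connected graph (parallel edges allowed) with a weight function $w:E\to\mathbb{R}^+$. Let $\mathcal{P}$ be the probability distribution on the spanning trees of $G$ in which each spanning tree has probability proportional to its weight. For any two distinct edges $e_1,e_2\in E$ such that $e_2$ is not a bridge (and not a loop), we have $$\mathrm{Pr}_{T\sim\mathcal{P}}[e_1\in T \mid e_2\notin T]\;\geq\;\mathrm{Pr}_{T\sim\mathcal{P}}[e_1\in T \mid e_2\in T].$$
   Context: Graphs are multigraphs: two vertices may be connected by several edges. Subgraphs are always spanning and are identified with their edge sets; in particular a spanning tree of $G$ is regarded as a subset of $E$. $\mathbb{R}^+$ denotes the positive reals. For $I\subseteq E$ the weight of $I$ is $w(I)=\prod_{e\in I}w(e)$. Let $\mathcal{T}$ be the set of all spanning trees of $G$ and $\|\mathcal{T}\|=\sum_{T\in\mathcal{T}}w(T)$. The distribution $\mathcal{P}$ is given by $\mathrm{Pr}_{T\sim\mathcal{P}}[T=T_0]=w(T_0)/\|\mathcal{T}\|$ for every fixed spanning tree $T_0$ of $G$. A bridge is an edge whose deletion disconnects $G$. *)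

theory Defs
  imports "HOL-Probability.Probability"
begin

(* Undirected multigraphs. An edge with a single end vertex is a loop; two different edges may have
   the same ends. (The trees of the AFP entry Graph_Theory only exclude directed cycles and are
   therefore not the trees of an undirected graph.) *)
record ('v, 'e) multigraph =
  verts :: "'v set"
  edges :: "'e set"
  ends :: "'e \<Rightarrow> 'v set"

definition finite_multigraph :: "('v, 'e) multigraph \<Rightarrow> bool" where
  "finite_multigraph G \<longleftrightarrow> finite (verts G) \<and> finite (edges G) \<and>
     (\<forall>e \<in> edges G. ends G e \<subseteq> verts G \<and> card (ends G e) \<in> {1, 2})"

definition loop :: "('v, 'e) multigraph \<Rightarrow> 'e \<Rightarrow> bool" where
  "loop G e \<longleftrightarrow> e \<in> edges G \<and> card (ends G e) = 1"

(* Subgraphs are spanning throughout, so a subgraph of G is given by its edge set F. *)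

definition adj :: "('v, 'e) multigraph \<Rightarrow> 'e set \<Rightarrow> ('v \<times> 'v) set" where
  "adj G F = {(u, v). \<exists>e \<in> F. ends G e = {u, v}}"

definition connected_subgraph :: "('v, 'e) multigraph \<Rightarrow> 'e set \<Rightarrow> bool" where
  "connected_subgraph G F \<longleftrightarrow> (\<forall>u \<in> verts G. \<forall>v \<in> verts G. (u, v) \<in> (adj G F)\<^sup>*)"

definition connected_multigraph :: "('v, 'e) multigraph \<Rightarrow> bool" where
  "connected_multigraph G \<longleftrightarrow> connected_subgraph G (edges G)"

definition bridge :: "('v, 'e) multigraph \<Rightarrow> 'e \<Rightarrow> bool" where
  "bridge G e \<longleftrightarrow> e \<in> edges G \<and> \<not> connected_subgraph G (edges G - {e})"

(* The i-th edge of the cycle joins the i-th and the (i+1)-st vertex, cyclically. A loop is a cycle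
   of length 1 and a pair of parallel edges is a cycle of length 2. *)
definition cycle :: "('v, 'e) multigraph \<Rightarrow> 'e set \<Rightarrow> 'v list \<Rightarrow> 'e list \<Rightarrow> bool" where
  "cycle G F vs es \<longleftrightarrow> es \<noteq> [] \<and> length vs = length es \<and> distinct vs \<and> distinct es \<and>
     set vs \<subseteq> verts G \<and> set es \<subseteq> F \<and>
     (\<forall>i < length es. ends G (es ! i) = {vs ! i, vs ! (Suc i mod length es)})"

definition spanning_tree :: "('v, 'e) multigraph \<Rightarrow> 'e set \<Rightarrow> bool" where
  "spanning_tree G T \<longleftrightarrow> T \<subseteq> edges G \<and> connected_subgraph G T \<and> (\<nexists>vs es. cycle G T vs es)"

definition spanning_trees :: "('v, 'e) multigraph \<Rightarrow> 'e set set" where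
  "spanning_trees G = {T. spanning_tree G T}"

definition weight :: "('e \<Rightarrow> real) \<Rightarrow> 'e set \<Rightarrow> real" where
  "weight w I = (\<Prod>e\<in>I. w e)"

definition total_weight :: "('v, 'e) multigraph \<Rightarrow> ('e \<Rightarrow> real) \<Rightarrow> real" where
  "total_weight G w = (\<Sum>T\<in>spanning_trees G. weight w T)"

(* embed_pmf is meaningful only for nonnegative functions with sum 1;
   see pmf_spanning_tree_pmf below. *)
definition spanning_tree_pmf :: "('v, 'e) multigraph \<Rightarrow> ('e \<Rightarrow> real) \<Rightarrow> 'e set pmf" where
  "spanning_tree_pmf G w =
     embed_pmf (\<lambda>T. if T \<in> spanning_trees G then weight w T / total_weight G w else 0)"

lemma finite_spanning_trees:
  assumes "finite_multigraph G"
  shows "finite (spanning_trees G)"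
proof (rule finite_subset)
  show "spanning_trees G \<subseteq> Pow (edges G)"
    by (auto simp: spanning_trees_def spanning_tree_def)
  show "finite (Pow (edges G))"
    using assms by (simp add: finite_multigraph_def)
qed

lemma sym_adj: "sym (adj G F)"
  by (auto simp: sym_def adj_def insert_commute)

lemma connected_subgraph_remove_cycle_edge:
  assumes conn: "connected_subgraph G F" and cyc: "cycle G F vs es"
  shows "connected_subgraph G (F - {hd es})"
proof -
  define k where "k = length es"
  define R where "R = adj G (F - {hd es})"
  have k: "k > 0" and d: "distinct es" and sub: "set es \<subseteq> F"
    and step: "\<And>i. i < k \<Longrightarrow> ends G (es ! i) = {vs ! i, vs ! (Suc i mod k)}"
    using cyc by (auto simp: cycle_def k_def)
  have hd: "hd es = es ! 0"
    using k by (simp add: k_def hd_conv_nth)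
  have symR: "sym (R\<^sup>*)"
    by (simp add: R_def sym_adj sym_rtrancl)
  have path: "Suc i \<le> k \<Longrightarrow> (vs ! (1 mod k), vs ! (Suc i mod k)) \<in> R\<^sup>*" for i
  proof (induction i)
    case 0
    then show ?case by simp
  next
    case (Suc i)
    have ne: "es ! Suc i \<noteq> hd es"
      using d Suc.prems k by (simp add: hd k_def nth_eq_iff_index_eq)
    have "es ! Suc i \<in> F"
      using Suc.prems sub by (auto simp: k_def)
    then have "(vs ! Suc i, vs ! (Suc (Suc i) mod k)) \<in> R"
      using step[of "Suc i"] Suc.prems ne by (auto simp: R_def adj_def)
    then show ?case
      using Suc by simp
  qed
  have "(vs ! (1 mod k), vs ! 0) \<in> R\<^sup>*"
    using path[of "k - 1"] k by simp
  then have ends_hd: "(vs ! 0, vs ! (1 mod k)) \<in> R\<^sup>*" "(vs ! (1 mod k), vs ! 0) \<in> R\<^sup>*"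
    using symR by (auto dest: symD)
  have "adj G F \<subseteq> R\<^sup>*"
  proof (clarify)
    fix u v assume "(u, v) \<in> adj G F"
    then obtain e where e: "e \<in> F" "ends G e = {u, v}"
      by (auto simp: adj_def)
    show "(u, v) \<in> R\<^sup>*"
    proof (cases "e = hd es")
      case True
      then have "{u, v} = {vs ! 0, vs ! (1 mod k)}"
        using e step[of 0] k by (simp add: hd)
      then show ?thesis
        using ends_hd by (auto simp: doubleton_eq_iff)
    next
      case False
      then show ?thesis
        using e by (auto simp: R_def adj_def)
    qed
  qed
  then have "(adj G F)\<^sup>* \<subseteq> R\<^sup>*"
    by (rule rtrancl_subset_rtrancl)
  then show ?thesis
    using conn by (auto simp: connected_subgraph_def R_def)
qed

lemma spanning_trees_nonempty:
  assumes "finite_multigraph G" "connected_multigraph G"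
  shows "spanning_trees G \<noteq> {}"
proof -
  let ?P = "\<lambda>F. F \<subseteq> edges G \<and> connected_subgraph G F"
  have "?P (edges G)"
    using assms by (simp add: connected_multigraph_def)
  then obtain T where T: "?P T" and min: "\<And>F. ?P F \<Longrightarrow> card T \<le> card F"
    using ex_has_least_nat[of ?P "edges G" card] by blast
  have fin: "finite T"
    using T assms by (auto simp: finite_multigraph_def intro: finite_subset)
  have "\<not> cycle G T vs es" for vs es
  proof
    assume cyc: "cycle G T vs es"
    then have "hd es \<in> T"
      by (auto simp: cycle_def)
    then have "card (T - {hd es}) < card T"
      using fin by (intro card_Diff1_less)
    moreover have "?P (T - {hd es})"
      using connected_subgraph_remove_cycle_edge[OF _ cyc] T by blast
    ultimately show False
      using min[of "T - {hd es}"] by simp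
  qed
  then show ?thesis
    using T by (auto simp: spanning_trees_def spanning_tree_def)
qed

lemma total_weight_pos:
  assumes "finite_multigraph G" "connected_multigraph G" "\<And>e. e \<in> edges G \<Longrightarrow> w e > 0"
  shows "total_weight G w > 0"
  unfolding total_weight_def
proof (rule sum_pos)
  show "weight w T > 0" if "T \<in> spanning_trees G" for T
  proof -
    have "T \<subseteq> edges G"
      using that by (simp add: spanning_trees_def spanning_tree_def)
    then show ?thesis
      unfolding weight_def by (intro prod_pos) (meson assms(3) subsetD)
  qed
qed (use assms finite_spanning_trees spanning_trees_nonempty in auto)

lemma pmf_spanning_tree_pmf:
  assumes "finite_multigraph G" "connected_multigraph G" "\<And>e. e \<in> edges G \<Longrightarrow> w e > 0"
  shows "pmf (spanning_tree_pmf G w) T =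
    (if T \<in> spanning_trees G then weight w T / total_weight G w else 0)"
  unfolding spanning_tree_pmf_def
proof (rule pmf_embed_pmf)
  let ?f = "\<lambda>T. if T \<in> spanning_trees G then weight w T / total_weight G w else 0"
  have tot: "total_weight G w > 0"
    using assms by (rule total_weight_pos)
  have fin: "finite (spanning_trees G)"
    using assms by (simp add: finite_spanning_trees)
  have weight_nonneg: "weight w T \<ge> 0" if "T \<in> spanning_trees G" for T
  proof -
    have "T \<subseteq> edges G"
      using that by (simp add: spanning_trees_def spanning_tree_def)
    then show ?thesis
      unfolding weight_def by (intro prod_nonneg) (meson assms(3) less_imp_le subsetD)
  qed
  show nonneg: "?f T \<ge> 0" for T
    using tot weight_nonneg by simp
  have "(\<integral>\<^sup>+T. ennreal (?f T) \<partial>count_space UNIV) = (\<Sum>T\<in>spanning_trees G. ennreal (?f T))"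
    by (rule nn_integral_count_space') (use fin in auto)
  also have "\<dots> = ennreal (\<Sum>T\<in>spanning_trees G. ?f T)"
    by (intro sum_ennreal nonneg)
  also have "(\<Sum>T\<in>spanning_trees G. ?f T) = 1"
    using tot by (simp add: sum_divide_distrib[symmetric] total_weight_def)
  finally show "(\<integral>\<^sup>+T. ennreal (?f T) \<partial>count_space UNIV) = 1"
    by simp
qed

end

theory Submission
  imports Defs
begin

text \<open>
  Let \<open>A\<close>, \<open>B\<close>, \<open>C\<close>, \<open>D\<close> be the total weights of the spanning trees that contain both edges, only
  \<open>e1\<close>, only \<open>e2\<close>, and neither. The claim \<open>A / (A + C) \<le> B / (B + D)\<close> amounts to \<open>A D \<le> B C\<close>, or,
  after adding \<open>B D\<close>, to \<open>D (A + B) \<le> B (C + D)\<close>. In the last form it is Rayleigh's monotonicity law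
  for electrical networks. View \<open>w\<close> as a conductance and let \<open>H \<subseteq> K\<close> be the networks left by
  deleting \<open>{e1, e2}\<close> and \<open>{e1}\<close>. By Kirchhoff, the effective resistance of a network \<open>S\<close> between the
  ends \<open>a\<close>, \<open>b\<close> of \<open>e1\<close> is \<open>R S / Z S\<close>, where \<open>Z S\<close> is the weight of the spanning trees of \<open>S\<close>
  and \<open>R S\<close> that of the forests that \<open>e1\<close> completes to a spanning tree. Here \<open>Z H = D\<close>,
  \<open>Z K = C + D\<close>, \<open>w(e1) R H = B\<close> and \<open>w(e1) R K = A + B\<close>, so the inequality says that adding the
  edge \<open>e2\<close> to \<open>H\<close> does not raise the resistance.

  Monotonicity follows from Cauchy-Schwarz for the energy form
  \<open>\<langle>f, g\<rangle>\<^sub>S = (\<Sum>e\<in>S. w(e) \<nabla>f(e) \<nabla>g(e))\<close> once a potential \<open>\<phi>\<^sub>S\<close> is known with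
  \<open>\<langle>\<phi>\<^sub>S, f\<rangle>\<^sub>S = Z S (f a - f b)\<close> for all \<open>f\<close> and \<open>\<phi>\<^sub>S a - \<phi>\<^sub>S b = R S\<close>:
  \<open>(Z H R K)\<^sup>2 = \<langle>\<phi>\<^sub>H, \<phi>\<^sub>K\<rangle>\<^sub>H\<^sup>2 \<le> \<langle>\<phi>\<^sub>H, \<phi>\<^sub>H\<rangle>\<^sub>H \<langle>\<phi>\<^sub>K, \<phi>\<^sub>K\<rangle>\<^sub>K = Z H R H Z K R K\<close>,
  where the inequality also uses that \<open>\<langle>f, f\<rangle>\<^sub>H \<le> \<langle>f, f\<rangle>\<^sub>K\<close>. Cancelling \<open>Z H R K\<close> gives the law.

  Kirchhoff's potential is a weighted sum over forests: a forest \<open>F\<close> counted by \<open>R S\<close> contributes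
  \<open>1/2\<close> on the side of \<open>a\<close> and \<open>-1/2\<close> on the side of \<open>b\<close>. Its gradient along an edge \<open>e\<close> vanishes
  unless \<open>e\<close> joins the two sides, that is, unless \<open>insert e F\<close> is a spanning tree. Regrouping the
  pairs \<open>(e, F)\<close> by the tree \<open>T = insert e F\<close> turns the energy into a sum over trees
  (lemma \<open>kirchhoff\<close>), and for each \<open>T\<close> the edges involved are those of its path from \<open>a\<close> to \<open>b\<close>,
  so the increments of \<open>f\<close> along them telescope to \<open>f a - f b\<close> (lemma \<open>tree_path_sum\<close>).
\<close>

section \<open>Spanning trees and connectivity\<close>

definition linked :: "('v, 'e) multigraph \<Rightarrow> 'e set \<Rightarrow> 'v \<Rightarrow> 'v \<Rightarrow> bool" where
  "linked G F x y \<longleftrightarrow> (x, y) \<in> (adj G F)\<^sup>*"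

text \<open>
  Acyclicity in terms of connectivity: no edge has its ends joined by the remaining edges. This form
  is stable under edge exchange and covers loops, whose ends are always linked.
\<close>

definition acyclic_set :: "('v, 'e) multigraph \<Rightarrow> 'e set \<Rightarrow> bool" where
  "acyclic_set G F \<longleftrightarrow> (\<forall>e\<in>F. \<forall>x y. ends G e = {x, y} \<longrightarrow> \<not> linked G (F - {e}) x y)"

lemma linked_refl [simp]: "linked G F x x"
  by (simp add: linked_def)

lemma linked_sym: "linked G F x y \<longleftrightarrow> linked G F y x"
  unfolding linked_def using sym_rtrancl[OF sym_adj] by (metis symD)

lemma linked_trans: "linked G F x y \<Longrightarrow> linked G F y z \<Longrightarrow> linked G F x z"
  unfolding linked_def by (rule rtrancl_trans)

lemma linked_cong: "linked G F x y \<Longrightarrow> linked G F x z \<longleftrightarrow> linked G F y z"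
  using linked_trans[of G F x y z] linked_trans[of G F y x z] linked_sym[of G F x y] by blast

lemma linked_edge: "e \<in> F \<Longrightarrow> ends G e = {x, y} \<Longrightarrow> linked G F x y"
  unfolding linked_def adj_def by blast

lemma linked_mono: "linked G F x y \<Longrightarrow> F \<subseteq> F' \<Longrightarrow> linked G F' x y"
  unfolding linked_def by (rule subsetD[OF rtrancl_mono]) (auto simp: adj_def)

text \<open>A walk that uses the new edge can be shortened to use it once, in one of the two directions.\<close>

lemma linked_insert:
  assumes "ends G e = {u, v}"
  shows "linked G (insert e F) x y \<longleftrightarrow>
    linked G F x y \<or> linked G F x u \<and> linked G F v y \<or> linked G F x v \<and> linked G F u y"
proof -
  have "adj G (insert e F) = insert (u, v) (insert (v, u) (adj G F))"
    using assms by (auto simp: adj_def doubleton_eq_iff)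
  moreover have "(u, v) \<in> (adj G F)\<^sup>* \<longleftrightarrow> (v, u) \<in> (adj G F)\<^sup>*"
    using linked_sym unfolding linked_def .
  ultimately show ?thesis
    by (auto simp: linked_def rtrancl_insert intro: rtrancl_trans)
qed

lemma acyclic_set_insert:
  assumes acyc: "acyclic_set G F" and ends: "ends G e = {u, v}" and sep: "\<not> linked G F u v"
  shows "acyclic_set G (insert e F)"
proof -
  have "e \<notin> F"
    using linked_edge ends sep by metis
  have "\<not> linked G (insert e F - {g}) x y" if g: "g \<in> insert e F" "ends G g = {x, y}" for g x y
  proof (cases "g = e")
    case True
    then have "{x, y} = {u, v}" "insert e F - {g} = F"
      using g ends \<open>e \<notin> F\<close> by auto
    then show ?thesis
      using sep linked_sym[of G F u v] by (auto simp: doubleton_eq_iff)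
  next
    case False
    then have gF: "g \<in> F" and eq: "insert e F - {g} = insert e (F - {g})"
      using g by auto
    have "\<not> linked G (F - {g}) x y"
      using acyc gF g by (auto simp: acyclic_set_def)
    moreover have "linked G F x y"
      using gF g by (intro linked_edge)
    moreover have "linked G F p q" if "linked G (F - {g}) p q" for p q
      using that by (rule linked_mono) auto
    \<comment> \<open>A detour around \<open>g\<close> through \<open>e\<close>, completed by \<open>g\<close>, would link the ends of \<open>e\<close> in \<open>F\<close>.\<close>
    ultimately show ?thesis
      unfolding eq linked_insert[OF ends] using sep by (metis linked_sym linked_trans)
  qed
  then show ?thesis
    by (auto simp: acyclic_set_def)
qed

text \<open>
  A shortest walk between the ends of \<open>e\<close> in the remaining edges repeats no vertex, hence no edge,
  and \<open>e\<close> closes it to a cycle. For a loop the walk has length zero.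
\<close>

lemma obtain_cycle:
  assumes fin: "finite_multigraph G" and T: "T \<subseteq> edges G"
    and e: "e \<in> T" "ends G e = {x, y}" and link: "linked G (T - {e}) x y"
  shows "\<exists>vs es. cycle G T vs es"
proof -
  let ?R = "adj G (T - {e})"
  obtain n where n: "(x, y) \<in> ?R ^^ n" and min: "\<And>m. (x, y) \<in> ?R ^^ m \<Longrightarrow> n \<le> m"
    using link ex_has_least_nat[of "\<lambda>n. (x, y) \<in> ?R ^^ n" _ id]
    by (auto simp: linked_def rtrancl_is_UN_relpow)
  then obtain f where f: "f 0 = x" "f n = y" "\<And>i. i < n \<Longrightarrow> (f i, f (Suc i)) \<in> ?R"
    by (auto simp: relpow_fun_conv)
  have seg: "(f i, f (i + k)) \<in> ?R ^^ k" if "i + k \<le> n" for i k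
    unfolding relpow_fun_conv using f(3) that by (intro exI[of _ "\<lambda>j. f (i + j)"]) auto
  have ne: "f i \<noteq> f j" if "i < j" "j \<le> n" for i j
  proof
    assume eq: "f i = f j"
    have "(x, f i) \<in> ?R ^^ i" "(f j, y) \<in> ?R ^^ (n - j)"
      using seg[of 0 i] seg[of j "n - j"] that f by auto
    then have "(x, y) \<in> ?R ^^ (i + (n - j))"
      using eq by (auto simp: relpow_add)
    then show False
      using min that by fastforce
  qed
  then have inj: "f i = f j \<longleftrightarrow> i = j" if "i \<le> n" "j \<le> n" for i j
    using that by (metis linorder_neqE_nat)
  have "\<exists>d\<in>T - {e}. ends G d = {f i, f (Suc i)}" if "i < n" for i
    using f(3)[OF that] by (auto simp: adj_def)
  then obtain g where g: "\<And>i. i < n \<Longrightarrow> g i \<in> T - {e} \<and> ends G (g i) = {f i, f (Suc i)}"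
    by metis
  have inj_g: "i = j" if "i < n" "j < n" "g i = g j" for i j
  proof -
    have "{f i, f (Suc i)} = {f j, f (Suc j)}"
      using g that by metis
    then show ?thesis
      using inj that by (auto simp: doubleton_eq_iff)
  qed
  have ends_verts: "ends G d \<subseteq> verts G" if "d \<in> T" for d
    using that T fin by (auto simp: finite_multigraph_def)
  have f_verts: "f i \<in> verts G" if "i \<le> n" for i
  proof (cases "i = n")
    case True
    then show ?thesis
      using f(2) e ends_verts by auto
  next
    case False
    then show ?thesis
      using g[of i] that ends_verts[of "g i"] by auto
  qed
  let ?vs = "map f [0..<Suc n]" and ?es = "map g [0..<n] @ [e]"
  have "distinct ?vs"
    unfolding distinct_map inj_on_def using inj by auto
  moreover have "distinct ?es"
    using g inj_g by (fastforce simp: distinct_map inj_on_def)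
  moreover have "ends G (?es ! i) = {?vs ! i, ?vs ! (Suc i mod length ?es)}" if "i < Suc n" for i
  proof (cases "i = n")
    case True
    then show ?thesis
      using e f by (auto simp: nth_append simp del: upt_Suc)
  next
    case False
    then show ?thesis
      using g[of i] that by (auto simp: nth_append simp del: upt_Suc)
  qed
  ultimately have "cycle G T ?vs ?es"
    unfolding cycle_def using g e f_verts by auto
  then show ?thesis
    by blast
qed

text \<open>
  An edge of a cycle in a connected subgraph can be removed without disconnecting it, so its
  ends stay linked; \<open>obtain_cycle\<close> is the converse.
\<close>

lemma spanning_tree_iff:
  assumes fin: "finite_multigraph G"
  shows "spanning_tree G T \<longleftrightarrow> T \<subseteq> edges G \<and> connected_subgraph G T \<and> acyclic_set G T"
proof -
  have "acyclic_set G T \<longleftrightarrow> (\<nexists>vs es. cycle G T vs es)"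
    if T: "T \<subseteq> edges G" and conn: "connected_subgraph G T"
  proof
    assume acyc: "acyclic_set G T"
    show "\<nexists>vs es. cycle G T vs es"
    proof clarify
      fix vs es assume cyc: "cycle G T vs es"
      then have "hd es \<in> T"
        by (auto simp: cycle_def)
      moreover have "card (ends G (hd es)) \<in> {1, 2}"
        using calculation T fin by (auto simp: finite_multigraph_def)
      then obtain x y where xy: "ends G (hd es) = {x, y}"
        by (auto simp: card_1_singleton_iff card_2_iff)
      moreover have "x \<in> verts G" "y \<in> verts G"
        using calculation T fin by (fastforce simp: finite_multigraph_def)+
      then have "linked G (T - {hd es}) x y"
        using connected_subgraph_remove_cycle_edge[OF conn cyc]
        by (auto simp: connected_subgraph_def linked_def)
      ultimately show False
        using acyc by (auto simp: acyclic_set_def)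
    qed
  next
    assume "\<nexists>vs es. cycle G T vs es"
    then show "acyclic_set G T"
      using obtain_cycle[OF fin T] by (auto simp: acyclic_set_def)
  qed
  then show ?thesis
    by (auto simp: spanning_tree_def)
qed

text \<open>
  Removing an edge from a spanning tree leaves two components, and any edge between them completes
  them to a spanning tree again. Applied with \<open>e1\<close> as the removed or as the added edge, this
  matches the two-component forests with the trees.
\<close>

lemma spanning_tree_exchange:
  assumes fin: "finite_multigraph G"
    and tree: "spanning_tree G (insert e F)" and "e \<notin> F"
    and g: "g \<in> edges G" "ends G g = {a, b}" "\<not> linked G F a b"
  shows "spanning_tree G (insert g F)"
proof -
  have sub: "insert e F \<subseteq> edges G" and conn: "connected_subgraph G (insert e F)"
    and acyc: "acyclic_set G (insert e F)"
    using tree by (auto simp: spanning_tree_iff[OF fin])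
  have "card (ends G e) \<in> {1, 2}"
    using sub fin by (auto simp: finite_multigraph_def)
  then obtain u v where uv: "ends G e = {u, v}"
    by (auto simp: card_1_singleton_iff card_2_iff)
  have verts: "u \<in> verts G" "a \<in> verts G" "b \<in> verts G"
    using sub uv g fin by (auto simp: finite_multigraph_def)
  have "\<not> linked G (F - {d}) x y" if "d \<in> F" "ends G d = {x, y}" for d x y
    using acyc that linked_mono[of G "F - {d}" x y "insert e F - {d}"]
    by (auto simp: acyclic_set_def)
  then have "acyclic_set G F"
    by (auto simp: acyclic_set_def)
  then have acyc': "acyclic_set G (insert g F)"
    using g by (intro acyclic_set_insert)
  have two_sides: "linked G F x u \<or> linked G F x v" if "x \<in> verts G" for x
  proof -
    have "linked G (insert e F) x u"
      using conn that verts by (auto simp: connected_subgraph_def linked_def)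
    then show ?thesis
      by (auto simp: linked_insert[OF uv])
  qed
  \<comment> \<open>The ends of \<open>g\<close> lie on different sides, so \<open>g\<close> links the two ends of \<open>e\<close>.\<close>
  have "linked G F a u \<and> linked G F b v \<or> linked G F a v \<and> linked G F b u"
    using two_sides[OF verts(2)] two_sides[OF verts(3)] g(3) linked_sym[of G F]
      linked_trans[of G F] by metis
  then have "linked G (insert g F) u v"
    unfolding linked_insert[OF g(2)] using linked_sym[of G F] by metis
  moreover have "linked G (insert g F) x u \<or> linked G (insert g F) x v" if "x \<in> verts G" for x
    using two_sides[OF that] by (blast intro: linked_mono)
  ultimately have "linked G (insert g F) x u" if "x \<in> verts G" for x
    using that by (meson linked_sym linked_trans)
  then have "linked G (insert g F) x y" if "x \<in> verts G" "y \<in> verts G" for x y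
    using that by (meson linked_sym linked_trans)
  then have "connected_subgraph G (insert g F)"
    by (simp add: connected_subgraph_def linked_def)
  then show ?thesis
    using acyc' g sub by (auto simp: spanning_tree_iff[OF fin])
qed

section \<open>Potentials\<close>

text \<open>
  An arbitrary orientation of the edges. Only products of two gradients along the same edge
  occur below, and these do not depend on it.
\<close>

definition endpoints :: "('v, 'e) multigraph \<Rightarrow> 'e \<Rightarrow> 'v \<times> 'v" where
  "endpoints G e = (SOME p. ends G e = {fst p, snd p})"

definition grad :: "('v, 'e) multigraph \<Rightarrow> ('v \<Rightarrow> real) \<Rightarrow> 'e \<Rightarrow> real" where
  "grad G f e = f (fst (endpoints G e)) - f (snd (endpoints G e))"

definition side :: "('v, 'e) multigraph \<Rightarrow> 'e set \<Rightarrow> 'v \<Rightarrow> 'v \<Rightarrow> real" where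
  "side G F a x = of_bool (linked G F a x)"

lemma ends_endpoints:
  assumes "finite_multigraph G" "e \<in> edges G"
  shows "ends G e = {fst (endpoints G e), snd (endpoints G e)}"
  unfolding endpoints_def
proof (rule someI_ex)
  have "card (ends G e) \<in> {1, 2}"
    using assms by (auto simp: finite_multigraph_def)
  then obtain x y where "ends G e = {x, y}"
    by (auto simp: card_1_singleton_iff card_2_iff)
  then show "\<exists>p. ends G e = {fst p, snd p}"
    by (intro exI[of _ "(x, y)"]) simp
qed

lemma grad_diff: "grad G (\<lambda>x. f x - g x) e = grad G f e - grad G g e"
  by (simp add: grad_def)

lemma grad_sum_scaled:
  "grad G (\<lambda>x. \<Sum>i\<in>I. c i * f i x) e = (\<Sum>i\<in>I. c i * grad G (f i) e)"
  by (simp add: grad_def sum_subtractf right_diff_distrib)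

lemma side_eq_if_linked: "linked G F a b \<Longrightarrow> side G F a = side G F b"
  by (simp add: side_def fun_eq_iff linked_cong[of G F a b])

lemma side_const_if_linked: "linked G F x y \<Longrightarrow> side G F a x = side G F a y"
  by (simp add: side_def linked_sym[of G F a] linked_cong[of G F x y])

text \<open>
  Removing \<open>e\<close> from \<open>T\<close> separates \<open>a\<close> from \<open>b\<close> exactly for the edges of the path between them, so
  this is a telescoping sum along the path. No path has to be constructed: written as
  \<open>s a - s b\<close>, the left side can be summed step by step along any walk in \<open>T\<close>, and for
  adjacent \<open>a\<close>, \<open>b\<close> only the edge joining them contributes. The factor 2 is the jump of \<open>side a - side b\<close> from \<open>1\<close> to \<open>-1\<close>.
\<close>

lemma tree_path_sum:
  assumes fin: "finite_multigraph G" and tree: "spanning_tree G T"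
    and "a \<in> verts G" "b \<in> verts G"
  shows "(\<Sum>e\<in>T. grad G (\<lambda>x. side G (T - {e}) a x - side G (T - {e}) b x) e * grad G f e)
    = 2 * (f a - f b)"
proof -
  have T: "T \<subseteq> edges G" and acyc: "acyclic_set G T" and conn: "connected_subgraph G T"
    using tree by (auto simp: spanning_tree_iff[OF fin])
  have "finite T"
    using T fin by (auto simp: finite_multigraph_def intro: finite_subset)
  define s where "s p = (\<Sum>e\<in>T. grad G (side G (T - {e}) p) e * grad G f e)" for p
  have step: "s u - s v = 2 * (f u - f v)" if adj: "(u, v) \<in> adj G T" for u v
  proof -
    from adj obtain e where e: "e \<in> T" "ends G e = {u, v}"
      by (auto simp: adj_def)
    have "side G (T - {d}) u = side G (T - {d}) v" if "d \<in> T - {e}" for d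
      using e that by (intro side_eq_if_linked linked_edge[of e]) auto
    then have "s u - s v =
      grad G (side G (T - {e}) u) e * grad G f e - grad G (side G (T - {e}) v) e * grad G f e"
      unfolding s_def sum.remove[OF \<open>finite T\<close> e(1)] by simp
    moreover have "\<not> linked G (T - {e}) u v" "\<not> linked G (T - {e}) v u"
      using acyc e linked_sym[of G "T - {e}" u v] by (auto simp: acyclic_set_def)
    moreover have "endpoints G e = (u, v) \<or> endpoints G e = (v, u)"
      using ends_endpoints[OF fin, of e] e T
      by (cases "endpoints G e") (auto simp: doubleton_eq_iff)
    ultimately show ?thesis
      by (auto simp: grad_def side_def)
  qed
  have "(a, b) \<in> (adj G T)\<^sup>*"
    using conn assms by (auto simp: connected_subgraph_def)
  then have "s a - s b = 2 * (f a - f b)"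
  proof induction
    case (step y z)
    then show ?case
      using \<open>\<And>u v. (u, v) \<in> adj G T \<Longrightarrow> s u - s v = 2 * (f u - f v)\<close>[of y z] by simp
  qed simp
  then show ?thesis
    by (simp add: s_def grad_diff left_diff_distrib sum_subtractf)
qed

section \<open>Kirchhoff's formula and Rayleigh monotonicity\<close>

locale weighted_multigraph =
  fixes G :: "('v, 'e) multigraph" and w :: "'e \<Rightarrow> real" and e1 :: 'e and a b :: 'v
  assumes fin: "finite_multigraph G"
    and pos: "\<And>e. e \<in> edges G \<Longrightarrow> w e > 0"
    and e1: "e1 \<in> edges G" and ends_e1: "ends G e1 = {a, b}"
begin

definition trees :: "'e set \<Rightarrow> 'e set set" where
  "trees S = {T. T \<subseteq> S \<and> spanning_tree G T}"

text \<open>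
  For \<open>S\<close> without \<open>e1\<close>, these are the two-component spanning forests of \<open>S\<close> that separate the ends
  of \<open>e1\<close>.
\<close>

definition forests :: "'e set \<Rightarrow> 'e set set" where
  "forests S = {F. F \<subseteq> S \<and> spanning_tree G (insert e1 F)}"

definition Z :: "'e set \<Rightarrow> real" where
  "Z S = (\<Sum>T\<in>trees S. weight w T)"

definition R :: "'e set \<Rightarrow> real" where
  "R S = (\<Sum>F\<in>forests S. weight w F)"

text \<open>
  \<open>potential S / Z S\<close> is the voltage, normalised to have opposite values at \<open>a\<close> and \<open>b\<close>, when a unit
  current enters at \<open>a\<close> and leaves at \<open>b\<close>.
\<close>

definition potential :: "'e set \<Rightarrow> 'v \<Rightarrow> real" where
  "potential S x = (\<Sum>F\<in>forests S. weight w F / 2 * (side G F a x - side G F b x))"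

definition energy :: "'e set \<Rightarrow> ('v \<Rightarrow> real) \<Rightarrow> ('v \<Rightarrow> real) \<Rightarrow> real" where
  "energy S f g = (\<Sum>e\<in>S. w e * grad G f e * grad G g e)"

lemma verts_ab: "a \<in> verts G" "b \<in> verts G"
  using fin e1 ends_e1 by (auto simp: finite_multigraph_def)

lemma finite_subgraph: "S \<subseteq> edges G \<Longrightarrow> finite S"
  using fin by (auto simp: finite_multigraph_def intro: finite_subset)

lemma finite_forests: "S \<subseteq> edges G \<Longrightarrow> finite (forests S)"
  by (rule finite_subset[of _ "Pow S"]) (auto simp: forests_def finite_subgraph)

lemma finite_trees: "S \<subseteq> edges G \<Longrightarrow> finite (trees S)"
  by (rule finite_subset[of _ "Pow S"]) (auto simp: trees_def finite_subgraph)

lemma weight_pos: "I \<subseteq> edges G \<Longrightarrow> weight w I > 0"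
  unfolding weight_def by (intro prod_pos) (meson pos subsetD)

lemma Z_nonneg: "S \<subseteq> edges G \<Longrightarrow> Z S \<ge> 0"
  unfolding Z_def by (intro sum_nonneg less_imp_le[OF weight_pos]) (auto simp: trees_def)

lemma R_nonneg: "S \<subseteq> edges G \<Longrightarrow> R S \<ge> 0"
  unfolding R_def by (intro sum_nonneg less_imp_le[OF weight_pos]) (auto simp: forests_def)

lemma potential_difference:
  assumes "e1 \<notin> S"
  shows "potential S a - potential S b = R S"
proof -
  have "weight w F / 2 * (side G F a a - side G F b a)
      - weight w F / 2 * (side G F a b - side G F b b) = weight w F" if F: "F \<in> forests S" for F
  proof -
    have "acyclic_set G (insert e1 F)" "e1 \<notin> F"
      using F assms by (auto simp: forests_def spanning_tree_iff[OF fin])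
    then have "\<not> linked G F a b"
      using ends_e1 by (auto simp: acyclic_set_def)
    then show ?thesis
      using linked_sym[of G F a b] by (simp add: side_def)
  qed
  then show ?thesis
    by (simp add: potential_def R_def flip: sum_subtractf)
qed

text \<open>
  The weak form of Kirchhoff's current law. Expanding the potential gives a sum over pairs of an edge
  \<open>e\<close> and a forest \<open>F\<close>; expanding the right side by \<open>tree_path_sum\<close> gives a sum over pairs of a tree \<open>T\<close>
  and one of its edges \<open>e\<close>. Moving \<open>e\<close> between \<open>F\<close> and \<open>T\<close> matches the terms that can be nonzero: on the
  one side those where \<open>e\<close> joins the two parts of \<open>F\<close>, on the other those where \<open>T - {e}\<close> separates \<open>a\<close> from \<open>b\<close>.
\<close>

lemma kirchhoff:
  assumes S: "S \<subseteq> edges G" and "e1 \<notin> S"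
  shows "energy S (potential S) f = Z S * (f a - f b)"
proof -
  let ?h = "\<lambda>F e. grad G (\<lambda>x. side G F a x - side G F b x) e * grad G f e"
  let ?A = "SIGMA e:S. forests S" and ?B = "SIGMA T:trees S. T"
  let ?A' = "{(e, F) \<in> ?A. e \<notin> F \<and> ?h F e \<noteq> 0}" and ?B' = "{(T, e) \<in> ?B. ?h (T - {e}) e \<noteq> 0}"
  have fin_T: "finite T" if "T \<in> trees S" for T
    using that S by (auto simp: trees_def intro: finite_subset finite_subgraph)
  have flat: "?h F e = 0" if "linked G F (fst (endpoints G e)) (snd (endpoints G e))" for e F
    using side_const_if_linked[OF that] by (simp add: grad_def)
  have grad_0: "?h F e = 0" if "e \<in> F" "e \<in> S" for e F
    using that S by (intro flat linked_edge[OF that(1)] ends_endpoints fin) auto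
  have fwd: "insert e F \<in> trees S" if "(e, F) \<in> ?A'" for e F
  proof -
    have eF: "e \<in> S" "e \<notin> F" "F \<in> forests S" "?h F e \<noteq> 0"
      using that by auto
    then have "\<not> linked G F (fst (endpoints G e)) (snd (endpoints G e))"
      using flat by blast
    then have "spanning_tree G (insert e F)"
      using eF S \<open>e1 \<notin> S\<close>
      by (intro spanning_tree_exchange[OF fin _ _ _ ends_endpoints[OF fin], of e1 F e])
        (auto simp: forests_def)
    then show ?thesis
      using eF by (auto simp: trees_def forests_def)
  qed
  have bwd: "T - {e} \<in> forests S" if "(T, e) \<in> ?B'" for T e
  proof -
    have Te: "e \<in> T" "T \<in> trees S" "?h (T - {e}) e \<noteq> 0"
      using that by auto
    have "\<not> linked G (T - {e}) a b"
      using Te(3) side_eq_if_linked[of G "T - {e}" a b] by (auto simp: grad_def)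
    then have "spanning_tree G (insert e1 (T - {e}))"
      using Te e1 ends_e1 by (intro spanning_tree_exchange[OF fin, of e "T - {e}" e1])
        (auto simp: trees_def insert_absorb)
    then show ?thesis
      using Te by (auto simp: trees_def forests_def)
  qed
  have "2 * energy S (potential S) f = (\<Sum>e\<in>S. \<Sum>F\<in>forests S. w e * weight w F * ?h F e)"
    unfolding energy_def potential_def grad_sum_scaled sum_distrib_left sum_distrib_right
    by (intro sum.cong refl) (simp add: mult_ac)
  also have "\<dots> = (\<Sum>(e, F)\<in>?A. w e * weight w F * ?h F e)"
    using S by (intro sum.Sigma) (auto intro: finite_subgraph finite_forests)
  also have "\<dots> = (\<Sum>(e, F)\<in>?A'. w e * weight w F * ?h F e)"
    using S grad_0
    by (intro sum.mono_neutral_right) (auto intro: finite_subgraph finite_forests)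
  also have "\<dots> = (\<Sum>(T, e)\<in>?B'. weight w T * ?h (T - {e}) e)"
  proof (rule sum.reindex_bij_witness
      [where i = "\<lambda>(T, e). (e, T - {e})" and j = "\<lambda>(e, F). (insert e F, e)"])
    fix p assume p: "p \<in> ?A'"
    then obtain e F where eF: "p = (e, F)" "e \<notin> F" "F \<subseteq> S"
      by (auto simp: forests_def)
    then have "weight w (insert e F) = w e * weight w F"
      using S by (auto simp: weight_def finite_subgraph)
    then show "(case case p of (e, F) \<Rightarrow> (insert e F, e) of (T, e) \<Rightarrow> weight w T * ?h (T - {e}) e)
      = (case p of (e, F) \<Rightarrow> w e * weight w F * ?h F e)"
      using eF by simp
    show "(case p of (e, F) \<Rightarrow> (insert e F, e)) \<in> ?B'"
      using p fwd[of e F] eF by auto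
    show "(case case p of (e, F) \<Rightarrow> (insert e F, e) of (T, e) \<Rightarrow> (e, T - {e})) = p"
      using eF by simp
  next
    fix p assume p: "p \<in> ?B'"
    then obtain T e where Te: "p = (T, e)" "e \<in> T" "T \<subseteq> S"
      by (auto simp: trees_def)
    show "(case p of (T, e) \<Rightarrow> (e, T - {e})) \<in> ?A'"
      using p bwd[of T e] Te by auto
    show "(case case p of (T, e) \<Rightarrow> (e, T - {e}) of (e, F) \<Rightarrow> (insert e F, e)) = p"
      using Te by auto
  qed
  also have "\<dots> = (\<Sum>(T, e)\<in>?B. weight w T * ?h (T - {e}) e)"
    using S by (intro sum.mono_neutral_left) (auto intro: fin_T finite_trees)
  also have "\<dots> = (\<Sum>T\<in>trees S. weight w T * (\<Sum>e\<in>T. ?h (T - {e}) e))"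
    using S by (subst sum.Sigma[symmetric]) (auto simp: sum_distrib_left fin_T intro: finite_trees)
  also have "\<dots> = (\<Sum>T\<in>trees S. weight w T * (2 * (f a - f b)))"
    using verts_ab by (intro sum.cong refl arg_cong2[where f = "(*)"] tree_path_sum fin)
      (auto simp: trees_def)
  also have "\<dots> = 2 * (Z S * (f a - f b))"
    by (simp add: Z_def flip: sum_distrib_right)
  finally show ?thesis
    by simp
qed

lemma energy_mono:
  assumes "H \<subseteq> K" "K \<subseteq> edges G"
  shows "energy H f f \<le> energy K f f"
  unfolding energy_def mult.assoc using assms
  by (intro sum_mono2 finite_subgraph mult_nonneg_nonneg[OF less_imp_le[OF pos] zero_le_square]) auto

lemma energy_Cauchy_Schwarz:
  assumes "S \<subseteq> edges G"
  shows "(energy S f g)\<^sup>2 \<le> energy S f f * energy S g g"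
proof -
  have "sqrt (w e) * sqrt (w e) = w e" if "e \<in> S" for e
    using pos[of e] assms that by auto
  then have eq: "energy S h k = (\<Sum>e\<in>S. (sqrt (w e) * grad G h e) * (sqrt (w e) * grad G k e))"
    for h k
    unfolding energy_def by (intro sum.cong refl) (metis mult.assoc mult.left_commute)
  show ?thesis
    unfolding eq
    using Cauchy_Schwarz_ineq_sum[of "\<lambda>e. sqrt (w e) * grad G f e" "\<lambda>e. sqrt (w e) * grad G g e" S]
    by (simp add: power2_eq_square)
qed

text \<open>
  If \<open>Z H\<close> and \<open>Z K\<close> are positive, this says that the effective resistance \<open>R / Z\<close> between \<open>a\<close> and \<open>b\<close>
  does not increase when edges are added. Cauchy-Schwarz is applied in the smaller network, since
  there the energy of \<open>potential K\<close> is bounded by its energy in \<open>K\<close>. Clearing denominators keeps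
  disconnected \<open>H\<close> included.
\<close>

lemma rayleigh_monotonicity:
  assumes HK: "H \<subseteq> K" and K: "K \<subseteq> edges G" and e1K: "e1 \<notin> K"
  shows "Z H * R K \<le> R H * Z K"
proof -
  let ?\<phi> = "potential H" and ?\<psi> = "potential K"
  have H: "H \<subseteq> edges G" "e1 \<notin> H"
    using assms by auto
  note nonneg = Z_nonneg[OF H(1)] Z_nonneg[OF K] R_nonneg[OF H(1)] R_nonneg[OF K]
  have energies: "energy H ?\<phi> ?\<psi> = Z H * R K" "energy H ?\<phi> ?\<phi> = Z H * R H"
    "energy K ?\<psi> ?\<psi> = Z K * R K"
    using kirchhoff[OF H] kirchhoff[OF K e1K] potential_difference[OF H(2)]
      potential_difference[OF e1K] by simp_all
  have "(Z H * R K)\<^sup>2 \<le> energy H ?\<phi> ?\<phi> * energy H ?\<psi> ?\<psi>"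
    using energy_Cauchy_Schwarz[OF H(1), of ?\<phi> ?\<psi>] by (simp add: energies)
  also have "\<dots> \<le> (Z H * R H) * (Z K * R K)"
    using energy_mono[OF HK K, of ?\<psi>] nonneg by (simp add: energies mult_left_mono)
  finally have "(Z H * R K) * (Z H * R K) \<le> (Z H * R K) * (R H * Z K)"
    by (simp add: power2_eq_square mult_ac)
  then show ?thesis
    using nonneg by (cases "Z H * R K = 0") (auto simp: mult_le_cancel_left)
qed

end

section \<open>Negative correlation\<close>

definition weight_where :: "('v, 'e) multigraph \<Rightarrow> ('e \<Rightarrow> real) \<Rightarrow> ('e set \<Rightarrow> bool) \<Rightarrow> real" where
  "weight_where G w P = (\<Sum>T | T \<in> spanning_trees G \<and> P T. weight w T)"

lemma prob_spanning_tree_pmf: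
  assumes "finite_multigraph G" "connected_multigraph G" "\<And>e. e \<in> edges G \<Longrightarrow> w e > 0"
  shows "\<P>(T in spanning_tree_pmf G w. P T) = weight_where G w P / total_weight G w"
proof -
  let ?p = "spanning_tree_pmf G w" and ?A = "{T. T \<in> spanning_trees G \<and> P T}"
  note pmf = pmf_spanning_tree_pmf[of G w, OF assms]
  have "set_pmf ?p \<subseteq> spanning_trees G"
    by (auto simp: set_pmf_iff pmf split: if_splits)
  then have "measure ?p {T. P T} = measure ?p ?A"
    by (intro measure_pmf.finite_measure_eq_AE) (auto simp: AE_measure_pmf_iff)
  also have "\<dots> = (\<Sum>T\<in>?A. pmf ?p T)"
    using assms by (intro measure_measure_pmf_finite) (simp add: finite_spanning_trees)
  also have "\<dots> = weight_where G w P / total_weight G w"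
    unfolding weight_where_def sum_divide_distrib by (intro sum.cong) (auto simp: pmf)
  finally show ?thesis
    by simp
qed

lemma cond_prob_spanning_tree_pmf:
  assumes "finite_multigraph G" "connected_multigraph G" "\<And>e. e \<in> edges G \<Longrightarrow> w e > 0"
  shows "\<P>(T in spanning_tree_pmf G w. P T \<bar> Q T) =
    weight_where G w (\<lambda>T. P T \<and> Q T) / weight_where G w Q"
  using total_weight_pos[of G w, OF assms]
  by (simp add: cond_prob_def prob_spanning_tree_pmf[of G w, OF assms, simplified])

lemma weight_where_split:
  assumes "finite_multigraph G"
  shows "weight_where G w P = weight_where G w (\<lambda>T. Q T \<and> P T) + weight_where G w (\<lambda>T. \<not> Q T \<and> P T)"
  unfolding weight_where_def using finite_spanning_trees[OF assms]
  by (subst sum.union_disjoint[symmetric]) (auto intro!: sum.cong)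

lemma weight_where_nonneg:
  assumes "\<And>e. e \<in> edges G \<Longrightarrow> w e > 0"
  shows "weight_where G w P \<ge> 0"
  unfolding weight_where_def weight_def
proof (intro sum_nonneg prod_nonneg ballI)
  fix T e assume "T \<in> {T. T \<in> spanning_trees G \<and> P T}" "e \<in> T"
  then show "0 \<le> w e"
    using assms[of e] by (auto simp: spanning_trees_def spanning_tree_def)
qed

text \<open>Deleting a non-bridge leaves a connected graph, whose spanning trees are spanning trees of \<open>G\<close>.\<close>

lemma weight_avoiding_nonbridge_pos:
  assumes "finite_multigraph G" "\<And>e. e \<in> edges G \<Longrightarrow> w e > 0" "d \<in> edges G" "\<not> bridge G d"
  shows "weight_where G w (\<lambda>T. d \<notin> T) > 0"
proof -
  let ?G' = "G\<lparr>edges := edges G - {d}\<rparr>"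
  have "spanning_trees ?G' \<noteq> {}"
    using assms by (intro spanning_trees_nonempty)
      (auto simp: finite_multigraph_def connected_multigraph_def bridge_def
        connected_subgraph_def adj_def)
  moreover have "spanning_trees ?G' = {T. T \<in> spanning_trees G \<and> d \<notin> T}"
    by (auto simp: spanning_trees_def spanning_tree_def connected_subgraph_def adj_def cycle_def)
  ultimately have "{T. T \<in> spanning_trees G \<and> d \<notin> T} \<noteq> {}"
    by simp
  then show ?thesis
    unfolding weight_where_def weight_def using finite_spanning_trees[OF assms(1)]
    by (intro sum_pos prod_pos assms(2)) (auto simp: spanning_trees_def spanning_tree_def
        intro: rev_finite_subset)
qed

text \<open>
  Monotonicity for the two networks obtained by deleting \<open>{e1, e2}\<close> and \<open>{e1}\<close>. Adding \<open>e1\<close> to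
  the forests makes them trees through \<open>e1\<close>, at the cost of a factor \<open>w e1\<close>; a term \<open>B D\<close> then
  cancels on both sides.
\<close>

lemma negative_correlation:
  fixes G :: "('v, 'e) multigraph"
  assumes fin: "finite_multigraph G" and pos: "\<And>e. e \<in> edges G \<Longrightarrow> w e > 0"
    and e: "e1 \<in> edges G" "e1 \<noteq> e2"
  shows "weight_where G w (\<lambda>T. e1 \<in> T \<and> e2 \<in> T) * weight_where G w (\<lambda>T. e1 \<notin> T \<and> e2 \<notin> T)
    \<le> weight_where G w (\<lambda>T. e1 \<in> T \<and> e2 \<notin> T) * weight_where G w (\<lambda>T. e1 \<notin> T \<and> e2 \<in> T)"
    (is "?A * ?D \<le> ?B * ?C")
proof -
  interpret weighted_multigraph G w e1 "fst (endpoints G e1)" "snd (endpoints G e1)"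
    using fin pos e(1) ends_endpoints[OF fin e(1)] by unfold_locales
  let ?K = "edges G - {e1}" and ?H = "edges G - {e1, e2}"
  have w1: "w e1 > 0"
    using pos e by simp
  have forests_eq: "w e1 * R S = weight_where G w (\<lambda>T. e1 \<in> T \<and> T \<subseteq> insert e1 S)"
    if S: "S \<subseteq> edges G" "e1 \<notin> S" for S
  proof -
    have "w e1 * R S = (\<Sum>F\<in>forests S. weight w (insert e1 F))"
      unfolding R_def sum_distrib_left
    proof (intro sum.cong refl)
      fix F assume "F \<in> forests S"
      then have "finite F" "e1 \<notin> F"
        using S by (auto simp: forests_def intro: finite_subgraph)
      then show "w e1 * weight w F = weight w (insert e1 F)"
        by (simp add: weight_def)
    qed
    also have "\<dots> = weight_where G w (\<lambda>T. e1 \<in> T \<and> T \<subseteq> insert e1 S)"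
      unfolding weight_where_def
      by (rule sum.reindex_bij_witness[of _ "\<lambda>T. T - {e1}" "insert e1"])
        (use S in \<open>auto simp: forests_def spanning_trees_def insert_absorb\<close>)
    finally show ?thesis .
  qed
  have cong: "weight_where G w P = weight_where G w Q"
    if "\<And>T. T \<subseteq> edges G \<Longrightarrow> P T \<longleftrightarrow> Q T" for P Q
    unfolding weight_where_def using that
    by (intro sum.cong) (auto simp: spanning_trees_def spanning_tree_def)
  have "w e1 * R ?H = ?B"
    using e by (subst forests_eq) (auto intro!: cong)
  moreover have "w e1 * R ?K = ?A + ?B"
  proof -
    have "w e1 * R ?K = weight_where G w (\<lambda>T. e1 \<in> T)"
      using e by (subst forests_eq) (auto intro!: cong)
    then show ?thesis
      by (simp add: weight_where_split[OF fin, of w "\<lambda>T. e1 \<in> T" "\<lambda>T. e2 \<in> T"] conj_commute)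
  qed
  moreover have "Z ?H = ?D"
    unfolding Z_def weight_where_def
    by (intro sum.cong) (auto simp: trees_def spanning_trees_def spanning_tree_def)
  moreover have "Z ?K = ?C + ?D"
  proof -
    have "Z ?K = weight_where G w (\<lambda>T. e1 \<notin> T)"
      unfolding Z_def weight_where_def
      by (intro sum.cong) (auto simp: trees_def spanning_trees_def spanning_tree_def)
    then show ?thesis
      by (simp add: weight_where_split[OF fin, of w "\<lambda>T. e1 \<notin> T" "\<lambda>T. e2 \<in> T"] conj_commute)
  qed
  moreover have "Z ?H * (w e1 * R ?K) \<le> (w e1 * R ?H) * Z ?K"
  proof -
    have "Z ?H * R ?K \<le> R ?H * Z ?K"
      by (rule rayleigh_monotonicity) auto
    then show ?thesis
      using w1 by (simp add: mult_ac)
  qed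
  ultimately show ?thesis
    by (simp add: algebra_simps)
qed

theorem corollary2:
  fixes G :: "('v, 'e) multigraph" and w :: "'e \<Rightarrow> real" and e1 e2 :: 'e
  assumes "finite_multigraph G"
    and "connected_multigraph G"
    and "\<And>e. e \<in> edges G \<Longrightarrow> w e > 0"
    and "e1 \<in> edges G" and "e2 \<in> edges G" and "e1 \<noteq> e2"
    and "\<not> bridge G e2" and "\<not> loop G e2"
  shows "\<P>(T in spanning_tree_pmf G w. e1 \<in> T \<bar> e2 \<notin> T)
       \<ge> \<P>(T in spanning_tree_pmf G w. e1 \<in> T \<bar> e2 \<in> T)"
proof -
  let ?W = "weight_where G w"
  let ?A = "?W (\<lambda>T. e1 \<in> T \<and> e2 \<in> T)" and ?B = "?W (\<lambda>T. e1 \<in> T \<and> e2 \<notin> T)"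
    and ?C = "?W (\<lambda>T. e1 \<notin> T \<and> e2 \<in> T)" and ?D = "?W (\<lambda>T. e1 \<notin> T \<and> e2 \<notin> T)"
  note split = weight_where_split[OF assms(1), of w _ "\<lambda>T. e1 \<in> T"]
  \<comment> \<open>Without this, the left conditional probability would be \<open>0 / 0\<close>, which is \<open>0\<close> by convention.\<close>
  have pos: "?B + ?D > 0"
    using weight_avoiding_nonbridge_pos[of G w e2, OF assms(1,3,5,7)] split[of "\<lambda>T. e2 \<notin> T"] by simp
  have nonneg: "?A \<ge> 0" "?B \<ge> 0" "?C \<ge> 0"
    by (simp_all add: weight_where_nonneg assms(3))
  have corr: "?A * ?D \<le> ?B * ?C"
    using assms by (intro negative_correlation) auto
  have "?A / (?A + ?C) \<le> ?B / (?B + ?D)"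
  proof (cases "?A + ?C = 0")
    case True
    then show ?thesis
      using nonneg pos by simp
  next
    case False
    then have "?A + ?C > 0"
      using nonneg by simp
    then show ?thesis
      using pos corr by (simp add: frac_le_eq divide_le_eq algebra_simps field_simps)
  qed
  then show ?thesis
    using cond_prob_spanning_tree_pmf[of G w "\<lambda>T. e1 \<in> T" "\<lambda>T. e2 \<in> T", OF assms(1-3)]
      cond_prob_spanning_tree_pmf[of G w "\<lambda>T. e1 \<in> T" "\<lambda>T. e2 \<notin> T", OF assms(1-3)]
      split[of "\<lambda>T. e2 \<in> T"] split[of "\<lambda>T. e2 \<notin> T"] by simp
qed

end
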